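(* Let $n\ge2$, $R>0$, $\lambda\in\mathbb{R}$, and let $B^n(R)$ be the open ball of radius $R$ centered at the origin in $\mathbb{R}^n$. Let $\mu$ be a positive Borel measure on $S^{n-1}$, and let $u(x)=\int_{S^{n-1}}P_\lambda\left(\frac xR,\xi\right)d\mu(\xi)$, $x\in B^n(R)$, be the positive invariant harmonic function in $B^n(R)$ defined by $\mu$ with the Poisson kernel $P_\lambda(\frac xR,\xi)$. Let $\zeta\in S^{n-1}$. (1) If $\lambda>-\frac n2$, then the function $$r\mapsto\frac{1}{R^{n-2-2\lambda}}\frac{(R-r)^{n-1}}{(R+r)^{1+2\lambda}}u(r\zeta)$$ is decreasing for $0\le r<R$, and the function $$r\mapsto\frac{1}{R^{n-2-2\lambda}}\frac{(R+r)^{n-1}}{(R-r)^{1+2\lambda}}u(r\zeta)$$ is increasing for $0\le r<R$. If $\lambda<-\frac n2$, then the first function is increasing and the second is decreasing for $0\le r<R$. (2) If $\lambda=0$, then on $0\le r<R$ the function $r\mapsto\left(\frac{R-r}{R}\right)^{n-2}\frac{R-r}{R+r}u(r\zeta)$ is decreasing and the function $r\mapsto\left(\frac{R+r}{R}\right)^{n-2}\frac{R+r}{R-r}u(r\zeta)$ is increasing; and for all $0\le r<R$ and all $x\in B^n(r)$, $$\left(\frac{R}{R+r}\right)^{n-2}\frac{R-r}{R+r}u(0)\le u(x)\le\left(\frac{R}{R-r}\right)^{n-2}\frac{R+r}{R-r}u(0).$$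
   Context: $B^n=\{x\in\mathbb{R}^n:|x|<1\}$, $S^{n-1}=\partial B^n$, and $B^n(r)$ is the open ball of radius $r$ centered at the origin. The Poisson kernel is $P_\lambda(x,\zeta)=\dfrac{(1-|x|^2)^{1+2\lambda}}{|x-\zeta|^{n+2\lambda}}$ for $x\in B^n$, $\zeta\in S^{n-1}$. A function $v$ on $B^n$ is invariant harmonic if $\Delta_\lambda v=0$, where $\Delta_\lambda=(1-|x|^2)\left\{\frac{1-|x|^2}{4}\sum_j\frac{\partial^2}{\partial x_j^2}+\lambda\sum_j x_j\frac{\partial}{\partial x_j}+\lambda\left(\frac n2-1-\lambda\right)\right\}$; a function $u$ on $B^n(R)$ is invariant harmonic if $x\mapsto u(Rx)$ is invariant harmonic in $B^n$. Positive means $0<u(x)<\infty$ for all $x\in B^n(R)$ (so $\mu$ is finite and nonzero). "Decreasing" and "increasing" are meant in the weak (non-strict) sense. *)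

theory Defs
  imports "HOL-Analysis.Analysis"
begin

definition partial_deriv :: "'n::finite \<Rightarrow> (real ^ 'n \<Rightarrow> real) \<Rightarrow> real ^ 'n \<Rightarrow> real" where
  "partial_deriv j v x = deriv (\<lambda>t. v (x + t *\<^sub>R axis j 1)) 0"

text \<open>On an open set this is the usual class of continuously differentiable functions:
  the partial derivatives exist and are continuous.\<close>

definition C1_on :: "(real ^ 'n::finite) set \<Rightarrow> (real ^ 'n \<Rightarrow> real) \<Rightarrow> bool" where
  "C1_on S v \<longleftrightarrow>
     (\<forall>j. (\<forall>x\<in>S. (\<lambda>t. v (x + t *\<^sub>R axis j 1)) field_differentiable (at 0)) \<and>
          continuous_on S (partial_deriv j v))"

definition C2_on :: "(real ^ 'n::finite) set \<Rightarrow> (real ^ 'n \<Rightarrow> real) \<Rightarrow> bool" where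
  "C2_on S v \<longleftrightarrow> C1_on S v \<and> (\<forall>j. C1_on S (partial_deriv j v))"

definition invariant_laplacian ::
    "real \<Rightarrow> (real ^ 'n::finite \<Rightarrow> real) \<Rightarrow> real ^ 'n \<Rightarrow> real" where
  "invariant_laplacian lam v x =
     (1 - (norm x)\<^sup>2) *
       ((1 - (norm x)\<^sup>2) / 4 * (\<Sum>j\<in>UNIV. partial_deriv j (partial_deriv j v) x)
        + lam * (\<Sum>j\<in>UNIV. x $ j * partial_deriv j v x)
        + lam * (real CARD('n) / 2 - 1 - lam) * v x)"

definition invariant_harmonic :: "real \<Rightarrow> (real ^ 'n::finite \<Rightarrow> real) \<Rightarrow> bool" where
  "invariant_harmonic lam v \<longleftrightarrow>
     C2_on (ball 0 1) v \<and> (\<forall>x\<in>ball 0 1. invariant_laplacian lam v x = 0)"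

text \<open>A function on the open ball of radius \<open>R\<close> about the origin; values of \<open>u\<close>
  outside that ball are irrelevant.\<close>

definition invariant_harmonic_ball ::
    "real \<Rightarrow> real \<Rightarrow> (real ^ 'n::finite \<Rightarrow> real) \<Rightarrow> bool" where
  "invariant_harmonic_ball R lam u \<longleftrightarrow> invariant_harmonic lam (\<lambda>x. u (R *\<^sub>R x))"

definition poisson_kernel :: "real \<Rightarrow> real ^ 'n::finite \<Rightarrow> real ^ 'n \<Rightarrow> real" where
  "poisson_kernel lam x \<xi> =
     (1 - (norm x)\<^sup>2) powr (1 + 2 * lam) / norm (x - \<xi>) powr (real CARD('n) + 2 * lam)"

text \<open>The remaining facts show that every finite positive Poisson integral is invariant
  harmonic, by differentiating twice under the integral; so for such functions invariant
  harmonicity is no additional restriction.  Here \<open>pk\<close> is the Poisson kernel with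
  free exponents, and \<open>pk1\<close>, \<open>pk2\<close> are its first and second partial derivatives.\<close>

definition pk :: "real \<Rightarrow> real \<Rightarrow> real ^ 'n::finite \<Rightarrow> real ^ 'n \<Rightarrow> real" where
  "pk p q x \<xi> = (1 - x \<bullet> x) powr p * ((x - \<xi>) \<bullet> (x - \<xi>)) powr (- q)"

lemma base_pos:
  assumes "x \<in> ball 0 1" "\<xi> \<in> sphere 0 (1::real)"
  shows "1 - x \<bullet> x > 0" "(x - \<xi>) \<bullet> (x - \<xi>) > 0"
proof -
  have "norm x < 1" using assms by simp
  then have "(norm x)^2 < 1" by (simp add: power_less_one_iff)
  then show "1 - x \<bullet> x > 0" by (simp add: power2_norm_eq_inner)
  have "x \<noteq> \<xi>" using assms by auto
  then show "(x - \<xi>) \<bullet> (x - \<xi>) > 0" by simp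
qed

definition pk1 where
  "pk1 p q j x \<xi> = - 2 * p * x $ j * pk (p - 1) q x \<xi> - 2 * q * (x $ j - \<xi> $ j) * pk p (q + 1) x \<xi>"

lemma pk_deriv:
  fixes x \<xi> :: "real ^ 'n::finite"
  assumes "x \<in> ball 0 1" "\<xi> \<in> sphere 0 1"
  shows "((\<lambda>t. pk p q (x + t *\<^sub>R axis j 1) \<xi>) has_real_derivative pk1 p q j x \<xi>) (at 0)"
proof -
  let ?e = "axis j 1 :: real ^ 'n"
  note pos = base_pos[OF assms]
  have A: "((\<lambda>t. 1 - (x + t *\<^sub>R ?e) \<bullet> (x + t *\<^sub>R ?e)) has_real_derivative - 2 * x $ j) (at 0)"
    by (auto intro!: derivative_eq_intros simp: inner_axis inner_axis' inner_add_left inner_add_right)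
  have D: "((\<lambda>t. (x + t *\<^sub>R ?e - \<xi>) \<bullet> (x + t *\<^sub>R ?e - \<xi>)) has_real_derivative 2 * (x $ j - \<xi> $ j)) (at 0)"
    by (auto intro!: derivative_eq_intros simp: inner_axis inner_axis' inner_diff_left inner_diff_right inner_add_left inner_add_right)
  have A': "((\<lambda>t. (1 - (x + t *\<^sub>R ?e) \<bullet> (x + t *\<^sub>R ?e)) powr p) has_real_derivative
       p * (1 - x \<bullet> x) powr (p - 1) * (- 2 * x $ j)) (at 0)"
    using DERIV_chain2[OF _ A, of "\<lambda>y. y powr p" "p * (1 - x \<bullet> x) powr (p - 1)"]
      has_real_derivative_powr[of "1 - x \<bullet> x" p] pos(1) by simp
  define DD where "DD = ((x - \<xi>) \<bullet> (x - \<xi>)) powr (- q - 1)"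
  have e: "((x - \<xi>) \<bullet> (x - \<xi>)) powr (- (q + 1)) = DD" unfolding DD_def by simp
  have D': "((\<lambda>t. ((x + t *\<^sub>R ?e - \<xi>) \<bullet> (x + t *\<^sub>R ?e - \<xi>)) powr (- q)) has_real_derivative
       (- q) * DD * (2 * (x $ j - \<xi> $ j))) (at 0)"
    using DERIV_chain2[OF _ D, of "\<lambda>y. y powr (- q)" "(- q) * DD"]
      has_real_derivative_powr[of "(x - \<xi>) \<bullet> (x - \<xi>)" "-q"] pos(2) by (simp add: DD_def)
  show ?thesis unfolding pk_def pk1_def e
    by (rule DERIV_cong[OF DERIV_mult[OF A' D']]) (simp add: algebra_simps)
qed

lemma pk_cont:
  "continuous_on (ball 0 1 \<times> sphere 0 1) (\<lambda>(x, \<xi>). pk p q (x::real^'n::finite) \<xi>)"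
proof -
  have hh: "1 - fst z \<bullet> fst z \<noteq> 0 \<and> (fst z - snd z) \<bullet> (fst z - snd z) \<noteq> 0"
    if z: "z \<in> ball (0::real^'n) 1 \<times> sphere 0 1" for z
  proof -
    have "fst z \<in> ball 0 1" "snd z \<in> sphere 0 1" using z by (auto simp only: mem_Times_iff)
    from base_pos[OF this] show ?thesis by linarith
  qed
  have h1: "\<forall>z\<in>ball (0::real^'n) 1 \<times> sphere (0::real^'n) 1. 1 - fst z \<bullet> fst z \<noteq> 0"
    by (rule ballI, erule hh[THEN conjunct1])
  have h2: "\<forall>z\<in>ball (0::real^'n) 1 \<times> sphere (0::real^'n) 1. (fst z - snd z) \<bullet> (fst z - snd z) \<noteq> 0"
    by (rule ballI, erule hh[THEN conjunct2])
  have c: "continuous_on (ball (0::real^'n) 1 \<times> sphere 0 1) (\<lambda>z. 1 - fst z \<bullet> fst z)"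
    "continuous_on (ball (0::real^'n) 1 \<times> sphere 0 1) (\<lambda>z. (fst z - snd z) \<bullet> (fst z - snd z))"
    by (intro continuous_intros)+
  show ?thesis unfolding pk_def case_prod_beta
    by (rule continuous_on_mult[OF continuous_on_powr[OF c(1) continuous_on_const h1]
          continuous_on_powr[OF c(2) continuous_on_const h2]])
qed

lemma pk1_cont:
  "continuous_on (ball 0 1 \<times> sphere 0 1) (\<lambda>(x, \<xi>). pk1 p q j (x::real^'n::finite) \<xi>)"
  using pk_cont unfolding pk1_def case_prod_beta
  by (intro continuous_intros) auto

definition pk2 where
  "pk2 p q i j x \<xi> =
     - 2 * p * (axis i 1 $ j * pk (p - 1) q x \<xi> + x $ j * pk1 (p - 1) q i x \<xi>)
     - 2 * q * (axis i 1 $ j * pk p (q + 1) x \<xi> + (x $ j - \<xi> $ j) * pk1 p (q + 1) i x \<xi>)"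

lemma pk1_deriv:
  fixes x \<xi> :: "real ^ 'n::finite"
  assumes "x \<in> ball 0 1" "\<xi> \<in> sphere 0 1"
  shows "((\<lambda>t. pk1 p q j (x + t *\<^sub>R axis i 1) \<xi>) has_real_derivative pk2 p q i j x \<xi>) (at 0)"
proof -
  have c: "((\<lambda>t. (x + t *\<^sub>R axis i 1) $ j) has_real_derivative axis i 1 $ j) (at 0)"
    by (auto intro!: derivative_eq_intros)
  have c': "((\<lambda>t. (x + t *\<^sub>R axis i 1) $ j - \<xi> $ j) has_real_derivative axis i 1 $ j) (at 0)"
    using DERIV_diff[OF c DERIV_const] by simp
  show ?thesis unfolding pk1_def[of p q]
    by (rule DERIV_cong[OF DERIV_diff[OF DERIV_mult[OF DERIV_cmult[OF c] pk_deriv[OF assms]]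
            DERIV_mult[OF DERIV_cmult[OF c'] pk_deriv[OF assms]]]])
       (simp add: pk2_def algebra_simps)
qed

lemma pk2_cont:
  "continuous_on (ball 0 1 \<times> sphere 0 1) (\<lambda>(x, \<xi>). pk2 p q i j (x::real^'n::finite) \<xi>)"
  using pk_cont pk1_cont unfolding pk2_def case_prod_beta
  by (intro continuous_intros) auto

lemma pk_pde:
  fixes x \<xi> :: "real ^ 'n::finite" and l :: real
  assumes "x \<in> ball 0 1" "\<xi> \<in> sphere 0 1"
  defines "a \<equiv> 1 + 2 * l" and "b \<equiv> real CARD('n) / 2 + l"
  shows "(1 - (norm x)\<^sup>2) / 4 * (\<Sum>j\<in>UNIV. pk2 a b j j x \<xi>)
        + l * (\<Sum>j\<in>UNIV. x $ j * pk1 a b j x \<xi>)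
        + l * (real CARD('n) / 2 - 1 - l) * pk a b x \<xi> = 0"
proof -
  define A where "A = 1 - x \<bullet> x"
  define D where "D = (x - \<xi>) \<bullet> (x - \<xi>)"
  define k where "k = pk a b x \<xi>"
  have pos: "A > 0" "D > 0" using base_pos[OF assms(1,2)] by (auto simp: A_def D_def)
  have n2: "(norm x)\<^sup>2 = 1 - A" by (simp add: A_def power2_norm_eq_inner)
  have x1: "\<xi> \<bullet> \<xi> = 1" using assms(2) by (simp add: dot_square_norm)
  have s1: "(\<Sum>j\<in>UNIV. x $ j * x $ j) = 1 - A" by (simp add: A_def inner_vec_def)
  have s2: "(\<Sum>j\<in>UNIV. x $ j * (x $ j - \<xi> $ j)) = (D - A) / 2"
  proof -
    have "(\<Sum>j\<in>UNIV. x $ j * (x $ j - \<xi> $ j)) = x \<bullet> (x - \<xi>)" by (simp add: inner_vec_def)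
    also have "\<dots> = (D - A) / 2" using x1
      by (simp add: A_def D_def inner_diff_left inner_diff_right inner_commute)
    finally show ?thesis .
  qed
  have s3: "(\<Sum>j\<in>UNIV. (x $ j - \<xi> $ j) * (x $ j - \<xi> $ j)) = D" by (simp add: D_def inner_vec_def)
  have pA: "A powr (p - 1) = A powr p / A" for p
    using pos by (simp add: powr_diff)
  have pD: "D powr (- (q + 1)) = D powr (- q) / D" for q
  proof -
    have "D powr (- (q + 1)) = D powr (- q - 1)" by simp
    also have "\<dots> = D powr (- q) / D" using pos by (simp only: powr_diff powr_one)
    finally show ?thesis .
  qed
  define kA kD kAA kAD kDD where "kA = k / A" and "kD = k / D" and "kAA = k / A / A"
    and "kAD = k / A / D" and "kDD = k / D / D"
  have kk: "pk (a - 1) b x \<xi> = kA" "pk a (b + 1) x \<xi> = kD"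
    "pk (a - 1 - 1) b x \<xi> = kAA" "pk (a - 1) (b + 1) x \<xi> = kAD"
    "pk a (b + 1 + 1) x \<xi> = kDD"
    unfolding kA_def kD_def kAA_def kAD_def kDD_def k_def pk_def A_def[symmetric] D_def[symmetric] pA pD
    by simp_all
  have rel: "A * kA = k" "D * kD = k" "A * kAA = kA" "A * kAD = kD" "D * kAD = kA" "D * kDD = kD"
    using pos by (simp_all add: kA_def kD_def kAA_def kAD_def kDD_def)
  have k1: "pk1 a b j x \<xi> = - 2 * a * kA * x $ j - 2 * b * kD * (x $ j - \<xi> $ j)" for j
    unfolding pk1_def kk by simp
  have k2: "pk2 a b j j x \<xi> = (- 2 * a * kA - 2 * b * kD)
     + 4 * a * (a - 1) * kAA * (x $ j * x $ j)
     + 8 * a * b * kAD * (x $ j * (x $ j - \<xi> $ j))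
     + 4 * b * (b + 1) * kDD * ((x $ j - \<xi> $ j) * (x $ j - \<xi> $ j))" for j
    unfolding pk2_def pk1_def kk by (simp add: algebra_simps)
  have S1: "(\<Sum>j\<in>UNIV. x $ j * pk1 a b j x \<xi>) = - 2 * a * kA * (1 - A) - 2 * b * kD * ((D - A) / 2)"
    unfolding s1[symmetric] s2[symmetric] k1 sum_distrib_left sum_subtractf[symmetric]
    by (intro sum.cong) (auto simp: algebra_simps)
  have S2: "(\<Sum>j\<in>UNIV. pk2 a b j j x \<xi>) = real CARD('n) * (- 2 * a * kA - 2 * b * kD)
     + 4 * a * (a - 1) * kAA * (1 - A)
     + 8 * a * b * kAD * ((D - A) / 2)
     + 4 * b * (b + 1) * kDD * D"
    unfolding k2 sum.distrib sum_distrib_left[symmetric] s1 s2 s3 by simp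
  have n: "real CARD('n) = 2 * (b - l)" by (simp add: b_def)
  have t1: "A / 4 * (2 * (b - l) * (- 2 * a * kA - 2 * b * kD)
     + 4 * a * (a - 1) * kAA * (1 - A)
     + 8 * a * b * kAD * ((D - A) / 2)
     + 4 * b * (b + 1) * kDD * D) =
     - (b - l) * a * (A * kA) - (b - l) * b * A * kD + a * (a - 1) * (A * kAA) - a * (a - 1) * A * (A * kAA)
     + a * b * A * (D * kAD) - a * b * A * (A * kAD) + b * (b + 1) * A * (D * kDD)"
    by (simp add: field_simps)
  have t2: "l * (- 2 * a * kA * (1 - A) - 2 * b * kD * ((D - A) / 2)) =
      - 2 * l * a * kA + 2 * l * a * (A * kA) - l * b * (D * kD) + l * b * A * kD"
    by (simp add: field_simps)
  have t3: "a * (a - 1) * A * kA = a * (a - 1) * (A * kA)" "a * b * A * kA = a * b * (A * kA)" by simp_all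
  have n3: "2 * (b - l) / 2 - 1 - l = b - 1 - 2 * l" by (simp add: field_simps)
  have n4: "1 - (1 - A) = A" by simp
  show ?thesis unfolding S1 S2 n2 k_def[symmetric] n n3 n4 t1 t2 rel t3
    by (simp add: a_def field_simps)
qed

context
  fixes \<mu> :: "(real ^ 'n::finite) measure"
  assumes fin: "finite_measure \<mu>" and sph: "sets \<mu> = sets (restrict_space borel (sphere 0 1))"
begin

interpretation finite_measure \<mu> by (fact fin)

lemma space_mu: "space \<mu> = sphere 0 1"
  using sets_eq_imp_space_eq[OF sph]
  by (simp add: space_restrict_space)

lemma bounded_dom:
  fixes F :: "real ^ 'n \<Rightarrow> real ^ 'n \<Rightarrow> real"
  assumes F: "continuous_on (ball 0 1 \<times> sphere 0 1) (\<lambda>(x, \<xi>). F x \<xi>)"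
    and C: "compact C" "C \<subseteq> ball 0 1"
  shows "\<exists>B. \<forall>x\<in>C. \<forall>\<xi>\<in>sphere 0 1. norm (F x \<xi>) \<le> B"
proof -
  have "compact ((\<lambda>(x, \<xi>). F x \<xi>) ` (C \<times> sphere 0 1))"
    using C by (intro compact_continuous_image compact_Times continuous_on_subset[OF F]) auto
  then have "bounded ((\<lambda>(x, \<xi>). F x \<xi>) ` (C \<times> sphere 0 1))" by (rule compact_imp_bounded)
  then show ?thesis unfolding bounded_iff by fastforce
qed

lemma meas_F:
  fixes F :: "real ^ 'n \<Rightarrow> real ^ 'n \<Rightarrow> real"
  assumes F: "continuous_on (ball 0 1 \<times> sphere 0 1) (\<lambda>(x, \<xi>). F x \<xi>)" and x: "x \<in> ball 0 1"
  shows "F x \<in> borel_measurable \<mu>"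
proof -
  have "continuous_on (sphere 0 1) ((\<lambda>(x, \<xi>). F x \<xi>) \<circ> (\<lambda>\<xi>. (x, \<xi>)))"
    using x by (intro continuous_on_compose continuous_on_subset[OF F] continuous_intros) auto
  then have "F x \<in> borel_measurable (restrict_space borel (sphere 0 1))"
    by (intro borel_measurable_continuous_on_restrict) (simp add: o_def)
  then show ?thesis
    using measurable_cong_sets[OF sph refl] by blast
qed

lemma int_F:
  fixes F :: "real ^ 'n \<Rightarrow> real ^ 'n \<Rightarrow> real"
  assumes F: "continuous_on (ball 0 1 \<times> sphere 0 1) (\<lambda>(x, \<xi>). F x \<xi>)" and x: "x \<in> ball 0 1"
  shows "integrable \<mu> (F x)"
proof -
  obtain B where "\<forall>\<xi>\<in>sphere 0 1. norm (F x \<xi>) \<le> B"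
    using bounded_dom[OF F, of "{x}"] x by auto
  then show ?thesis
    by (intro integrable_const_bound[of _ B] meas_F[OF F x]) (auto simp: space_mu)
qed

lemma int_cont:
  fixes F :: "real ^ 'n \<Rightarrow> real ^ 'n \<Rightarrow> real"
  assumes F: "continuous_on (ball 0 1 \<times> sphere 0 1) (\<lambda>(x, \<xi>). F x \<xi>)"
  shows "continuous_on (ball 0 1) (\<lambda>x. \<integral>\<xi>. F x \<xi> \<partial>\<mu>)"
  unfolding continuous_on_sequentially o_def
proof (intro allI ballI impI)
  fix X x assume x: "x \<in> ball 0 1" and "(\<forall>n. X n \<in> ball 0 (1::real)) \<and> X \<longlonglongrightarrow> (x::real^'n)"
  then have X: "\<And>n. X n \<in> ball 0 1" and lim: "X \<longlonglongrightarrow> x" by auto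
  have "compact (insert x (range X))" using compact_sequence_with_limit[OF lim] .
  then obtain B where B: "\<And>y \<xi>. y \<in> insert x (range X) \<Longrightarrow> \<xi> \<in> sphere 0 1 \<Longrightarrow> norm (F y \<xi>) \<le> B"
    using bounded_dom[OF F, of "insert x (range X)"] x X by (metis image_subset_iff insert_subset)
  have "(\<lambda>n. F (X n) \<xi>) \<longlonglongrightarrow> F x \<xi>" if "\<xi> \<in> sphere 0 1" for \<xi>
  proof -
    have c: "continuous_on (ball 0 1) (\<lambda>x. F x \<xi>)"
    proof -
      have "continuous_on (ball 0 1) ((\<lambda>(x, \<xi>). F x \<xi>) \<circ> (\<lambda>x. (x, \<xi>)))"
        using that by (intro continuous_on_compose continuous_on_subset[OF F] continuous_intros) auto
      then show ?thesis by (simp add: o_def)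
    qed
    show ?thesis using continuous_on_tendsto_compose[OF c lim x] X by simp
  qed
  then show "(\<lambda>n. \<integral>\<xi>. F (X n) \<xi> \<partial>\<mu>) \<longlonglongrightarrow> (\<integral>\<xi>. F x \<xi> \<partial>\<mu>)"
    using B by (intro integral_dominated_convergence[where w="\<lambda>_. B"] meas_F[OF F] X x
        integrable_const AE_I2) (simp_all add: space_mu)
qed

lemma int_deriv:
  fixes F G :: "real ^ 'n \<Rightarrow> real ^ 'n \<Rightarrow> real"
  assumes F: "continuous_on (ball 0 1 \<times> sphere 0 1) (\<lambda>(x, \<xi>). F x \<xi>)"
    and G: "continuous_on (ball 0 1 \<times> sphere 0 1) (\<lambda>(x, \<xi>). G x \<xi>)"
    and FG: "\<And>x \<xi>. x \<in> ball 0 1 \<Longrightarrow> \<xi> \<in> sphere 0 1 \<Longrightarrow>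
      ((\<lambda>t. F (x + t *\<^sub>R axis j 1) \<xi>) has_real_derivative G x \<xi>) (at 0)"
    and x: "x \<in> ball 0 1"
  shows "((\<lambda>t. \<integral>\<xi>. F (x + t *\<^sub>R axis j 1) \<xi> \<partial>\<mu>) has_real_derivative (\<integral>\<xi>. G x \<xi> \<partial>\<mu>)) (at 0)"
proof -
  let ?e = "axis j 1 :: real ^ 'n"
  obtain r where r: "r > 0" "cball x r \<subseteq> ball 0 1"
    using x open_contains_cball[of "ball 0 (1::real)"] by blast
  obtain B where B: "\<And>y \<xi>. y \<in> cball x r \<Longrightarrow> \<xi> \<in> sphere 0 1 \<Longrightarrow> norm (G y \<xi>) \<le> B"
    using bounded_dom[OF G compact_cball r(2)] by blast
  have inb: "x + t *\<^sub>R ?e \<in> cball x r" if "t \<in> cball 0 r" for t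
    using that by (simp add: dist_norm)
  have q: "norm ((F (x + h *\<^sub>R ?e) \<xi> - F x \<xi>) / h) \<le> B"
    if h: "h \<in> cball 0 r" "h \<noteq> 0" and xi: "\<xi> \<in> sphere 0 1" for h \<xi>
  proof -
    have "norm (F (x + h *\<^sub>R ?e) \<xi> - F (x + 0 *\<^sub>R ?e) \<xi>) \<le> B * norm (h - 0)"
    proof (rule field_differentiable_bound[of "cball 0 r" "\<lambda>t. F (x + t *\<^sub>R ?e) \<xi>" "\<lambda>t. G (x + t *\<^sub>R ?e) \<xi>"])
      fix z :: real assume z: "z \<in> cball 0 r"
      have "((\<lambda>t. F ((x + z *\<^sub>R ?e) + t *\<^sub>R ?e) \<xi>) has_real_derivative G (x + z *\<^sub>R ?e) \<xi>) (at 0)"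
        using FG inb[OF z] r xi by blast
      then have "((\<lambda>t. F (x + (t + z) *\<^sub>R ?e) \<xi>) has_real_derivative G (x + z *\<^sub>R ?e) \<xi>) (at 0)"
        by (simp add: algebra_simps)
      then have "((\<lambda>t. F (x + t *\<^sub>R ?e) \<xi>) has_real_derivative G (x + z *\<^sub>R ?e) \<xi>) (at z)"
        using DERIV_shift[of "\<lambda>t. F (x + t *\<^sub>R ?e) \<xi>" _ 0 z] by simp
      then show "((\<lambda>t. F (x + t *\<^sub>R ?e) \<xi>) has_real_derivative G (x + z *\<^sub>R ?e) \<xi>) (at z within cball 0 r)"
        by (rule has_field_derivative_at_within)
      show "norm (G (x + z *\<^sub>R ?e) \<xi>) \<le> B" using B inb[OF z] xi by blast
    qed (use h r in auto)
    then show ?thesis using h by (simp add: divide_simps)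
  qed
  have at: "at 0 within cball 0 r = at (0::real)"
    using r by (intro at_within_interior) auto
  have "((\<lambda>h. ((\<integral>\<xi>. F (x + h *\<^sub>R ?e) \<xi> \<partial>\<mu>) - (\<integral>\<xi>. F x \<xi> \<partial>\<mu>)) / h) \<longlongrightarrow> (\<integral>\<xi>. G x \<xi> \<partial>\<mu>)) (at 0 within cball 0 r)"
    unfolding tendsto_at_iff_sequentially
  proof (intro allI impI)
    fix X :: "nat \<Rightarrow> real" assume X: "\<forall>i. X i \<in> cball 0 r - {0}" and lim: "X \<longlonglongrightarrow> 0"
    have Xb: "x + X i *\<^sub>R ?e \<in> ball 0 1" for i using X inb r by blast
    have X0: "X i \<noteq> 0" for i using X by blast
    have l: "(\<lambda>i. (F (x + X i *\<^sub>R ?e) \<xi> - F x \<xi>) / X i) \<longlonglongrightarrow> G x \<xi>" if "\<xi> \<in> sphere 0 1" for \<xi>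
    proof -
      have "((\<lambda>h. (F (x + h *\<^sub>R ?e) \<xi> - F x \<xi>) / h) \<longlongrightarrow> G x \<xi>) (at 0)"
        using FG[OF x that] by (simp add: DERIV_def)
      then show ?thesis
        using lim X0 by (auto simp: tendsto_at_iff_sequentially o_def)
    qed
    have "(\<lambda>i. \<integral>\<xi>. (F (x + X i *\<^sub>R ?e) \<xi> - F x \<xi>) / X i \<partial>\<mu>) \<longlonglongrightarrow> (\<integral>\<xi>. G x \<xi> \<partial>\<mu>)"
      using X l q int_F[OF F Xb] int_F[OF F x]
      by (intro integral_dominated_convergence[where w="\<lambda>_. B"] borel_measurable_integrable
            integrable_divide integrable_diff int_F[OF F] int_F[OF G] Xb x integrable_const AE_I2)
         (auto simp: space_mu)
    then show "((\<lambda>h. ((\<integral>\<xi>. F (x + h *\<^sub>R ?e) \<xi> \<partial>\<mu>) - (\<integral>\<xi>. F x \<xi> \<partial>\<mu>)) / h) \<circ> X) \<longlonglongrightarrow> (\<integral>\<xi>. G x \<xi> \<partial>\<mu>)"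
      by (simp add: o_def int_F[OF F Xb] int_F[OF F x])
  qed
  then show ?thesis unfolding at by (simp add: DERIV_def)
qed

lemma pd_cong:
  fixes v w :: "real ^ 'n \<Rightarrow> real"
  assumes "open S" "x \<in> S" "\<And>y. y \<in> S \<Longrightarrow> v y = w y"
    and w: "((\<lambda>t. w (x + t *\<^sub>R axis j 1)) has_real_derivative d) (at 0)"
  shows "((\<lambda>t. v (x + t *\<^sub>R axis j 1)) has_real_derivative d) (at 0)"
proof -
  have "open ((\<lambda>t::real. x + t *\<^sub>R axis j 1) -` S)"
    by (intro continuous_open_vimage assms continuous_intros)
  then show ?thesis
    using has_field_derivative_transform_within_open[OF w, of _ "\<lambda>t. v (x + t *\<^sub>R axis j 1)"] assms
    by (metis (no_types, lifting) add.right_neutral scaleR_zero_left vimageD vimageI2)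
qed

lemma int_harm:
  fixes v :: "real ^ 'n \<Rightarrow> real" and l :: real
  defines "a \<equiv> 1 + 2 * l" and "b \<equiv> real CARD('n) / 2 + l"
  assumes v: "\<And>x. x \<in> ball 0 1 \<Longrightarrow> v x = (\<integral>\<xi>. pk a b x \<xi> \<partial>\<mu>)"
  shows "invariant_harmonic l v"
proof -
  have d1: "((\<lambda>t. v (x + t *\<^sub>R axis j 1)) has_real_derivative (\<integral>\<xi>. pk1 a b j x \<xi> \<partial>\<mu>)) (at 0)"
    if "x \<in> ball 0 1" for x j
    by (rule pd_cong[OF open_ball that v int_deriv[OF pk_cont pk1_cont pk_deriv that]]) auto
  have p1: "partial_deriv j v x = (\<integral>\<xi>. pk1 a b j x \<xi> \<partial>\<mu>)" if "x \<in> ball 0 1" for x j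
    unfolding partial_deriv_def using d1[OF that] by (rule DERIV_imp_deriv)
  have d2: "((\<lambda>t. partial_deriv j v (x + t *\<^sub>R axis i 1)) has_real_derivative (\<integral>\<xi>. pk2 a b i j x \<xi> \<partial>\<mu>)) (at 0)"
    if "x \<in> ball 0 1" for x i j
    by (rule pd_cong[OF open_ball that p1 int_deriv[OF pk1_cont pk2_cont pk1_deriv that]]) auto
  have p2: "partial_deriv i (partial_deriv j v) x = (\<integral>\<xi>. pk2 a b i j x \<xi> \<partial>\<mu>)" if "x \<in> ball 0 1" for x i j
    unfolding partial_deriv_def[of i] using d2[OF that] by (rule DERIV_imp_deriv)
  have C: "C2_on (ball 0 1) v"
    unfolding C2_on_def C1_on_def
  proof (intro conjI allI ballI)
    fix i j :: 'n
    show "continuous_on (ball 0 1) (partial_deriv j v)"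
      using int_cont[OF pk1_cont] by (rule continuous_on_eq) (simp add: p1)
    show "continuous_on (ball 0 1) (partial_deriv i (partial_deriv j v))"
      using int_cont[OF pk2_cont] by (rule continuous_on_eq) (simp add: p2)
    show "(\<lambda>t. v (x + t *\<^sub>R axis j 1)) field_differentiable (at 0)" if "x \<in> ball 0 1" for x
      using d1[OF that] unfolding field_differentiable_def by (rule exI)
    show "(\<lambda>t. partial_deriv j v (x + t *\<^sub>R axis i 1)) field_differentiable (at 0)" if "x \<in> ball 0 1" for x
      using d2[OF that] unfolding field_differentiable_def by (rule exI)
  qed
  have "invariant_laplacian l v x = 0" if x: "x \<in> ball 0 1" for x
  proof -
    have i0: "integrable \<mu> (pk a b x)" and i1: "\<And>j. integrable \<mu> (pk1 a b j x)"
      and i2: "\<And>i j. integrable \<mu> (pk2 a b i j x)"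
      using int_F[OF pk_cont x] int_F[OF pk1_cont x] int_F[OF pk2_cont x] by blast+
    have "invariant_laplacian l v x = (1 - (norm x)\<^sup>2) *
      (\<integral>\<xi>. (1 - (norm x)\<^sup>2) / 4 * (\<Sum>j\<in>UNIV. pk2 a b j j x \<xi>)
        + l * (\<Sum>j\<in>UNIV. x $ j * pk1 a b j x \<xi>)
        + l * (real CARD('n) / 2 - 1 - l) * pk a b x \<xi> \<partial>\<mu>)"
      unfolding invariant_laplacian_def p1[OF x] p2[OF x] v[OF x]
      using i0 i1 i2 by simp
    also have "(\<integral>\<xi>. (1 - (norm x)\<^sup>2) / 4 * (\<Sum>j\<in>UNIV. pk2 a b j j x \<xi>)
        + l * (\<Sum>j\<in>UNIV. x $ j * pk1 a b j x \<xi>)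
        + l * (real CARD('n) / 2 - 1 - l) * pk a b x \<xi> \<partial>\<mu>) = (\<integral>\<xi>. 0 \<partial>\<mu>)"
      unfolding a_def b_def
      by (intro Bochner_Integration.integral_cong refl pk_pde[OF x]) (simp add: space_mu)
    finally show ?thesis by simp
  qed
  then show ?thesis using C by (simp add: invariant_harmonic_def)
qed

end

lemma pk_poisson:
  fixes x \<xi> :: "real ^ 'n::finite"
  assumes "x \<in> ball 0 1" "\<xi> \<in> sphere 0 1"
  shows "poisson_kernel l x \<xi> = pk (1 + 2 * l) (real CARD('n) / 2 + l) x \<xi>"
proof -
  have "norm (x - \<xi>) > 0" using assms by auto
  then have "norm (x - \<xi>) powr (real CARD('n) + 2 * l) = ((norm (x - \<xi>))\<^sup>2) powr (real CARD('n) / 2 + l)"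
    by (simp add: powr_powr flip: powr_numeral)
  then show ?thesis unfolding poisson_kernel_def pk_def power2_norm_eq_inner
    by (simp only: powr_minus divide_inverse)
qed

theorem poisson_integral_invariant_harmonic:
  fixes \<mu> :: "(real ^ 'n::finite) measure"
  assumes R: "0 < R"
    and m: "sets \<mu> = sets (restrict_space borel (sphere 0 1))"
    and pos: "\<And>x. x \<in> ball 0 R \<Longrightarrow> 0 < u x"
    and u: "\<And>x. x \<in> ball 0 R \<Longrightarrow>
          ennreal (u x) = (\<integral>\<^sup>+ \<xi>. ennreal (poisson_kernel l (x /\<^sub>R R) \<xi>) \<partial>\<mu>)"
  shows "invariant_harmonic_ball R l u"
proof -
  have sp: "space \<mu> = sphere 0 1"
    using sets_eq_imp_space_eq[OF m]
    by (simp add: space_restrict_space)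
  have ux: "ennreal (u (R *\<^sub>R x)) = (\<integral>\<^sup>+ \<xi>. ennreal (poisson_kernel l x \<xi>) \<partial>\<mu>)" "0 < u (R *\<^sub>R x)"
    if "x \<in> ball 0 1" for x
  proof -
    have "R *\<^sub>R x \<in> ball 0 R" using that R by simp
    then have h: "0 < u (R *\<^sub>R x) \<and> ennreal (u (R *\<^sub>R x)) = (\<integral>\<^sup>+ \<xi>. ennreal (poisson_kernel l ((R *\<^sub>R x) /\<^sub>R R) \<xi>) \<partial>\<mu>)"
      using u pos by blast
    then show "ennreal (u (R *\<^sub>R x)) = (\<integral>\<^sup>+ \<xi>. ennreal (poisson_kernel l x \<xi>) \<partial>\<mu>)" "0 < u (R *\<^sub>R x)"
      using R by auto
  qed
  have "ennreal (u 0) = (\<integral>\<^sup>+ \<xi>. 1 \<partial>\<mu>)"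
  proof -
    have "ennreal (u 0) = (\<integral>\<^sup>+ \<xi>. ennreal (poisson_kernel l 0 \<xi>) \<partial>\<mu>)" using ux(1)[of 0] by simp
    also have "\<dots> = (\<integral>\<^sup>+ \<xi>. 1 \<partial>\<mu>)"
      by (intro nn_integral_cong) (simp add: sp poisson_kernel_def)
    finally show ?thesis .
  qed
  then have "emeasure \<mu> (space \<mu>) \<noteq> \<infinity>" by (metis ennreal_neq_top infinity_ennreal_def nn_integral_const mult_1)
  then have fm: "finite_measure \<mu>" by (rule finite_measureI)
  have "u (R *\<^sub>R x) = (\<integral>\<xi>. pk (1 + 2 * l) (real CARD('n) / 2 + l) x \<xi> \<partial>\<mu>)" if x: "x \<in> ball 0 1" for x
  proof -
    have "ennreal (u (R *\<^sub>R x)) = (\<integral>\<^sup>+ \<xi>. ennreal (pk (1 + 2 * l) (real CARD('n) / 2 + l) x \<xi>) \<partial>\<mu>)"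
      unfolding ux(1)[OF x] by (intro nn_integral_cong) (simp add: sp pk_poisson[OF x])
    also have "\<dots> = ennreal (\<integral>\<xi>. pk (1 + 2 * l) (real CARD('n) / 2 + l) x \<xi> \<partial>\<mu>)"
      by (intro nn_integral_eq_integral int_F[OF fm m pk_cont x]) (simp add: pk_def)
    finally have "ennreal (u (R *\<^sub>R x)) = ennreal (\<integral>\<xi>. pk (1 + 2 * l) (real CARD('n) / 2 + l) x \<xi> \<partial>\<mu>)" .
    moreover have "0 \<le> (\<integral>\<xi>. pk (1 + 2 * l) (real CARD('n) / 2 + l) x \<xi> \<partial>\<mu>)"
      by (rule integral_nonneg_AE) (simp add: pk_def)
    ultimately show ?thesis using ux(2)[OF x] by (simp only: ennreal_inj less_imp_le)
  qed
  then show ?thesis unfolding invariant_harmonic_ball_def by (intro int_harm[OF fm m])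
qed

end

theory Submission
  imports Defs
begin

text \<open>
  The weights in the statement are exactly those that turn the Poisson kernel on a ray into a
  power of a single ratio. Since \<open>1 - |x|\<^sup>2\<close> factors as \<open>(R - r) (R + r) / R\<^sup>2\<close> at \<open>x = (r / R) \<zeta>\<close>,
  one of the two factors cancels against the weight and the other one joins it, so that
  weight times kernel is \<open>((R - r) / |r \<zeta> - R \<xi>|)\<close>, respectively \<open>((R + r) / |r \<zeta> - R \<xi>|)\<close>,
  raised to the power \<open>n + 2 \<lambda>\<close> (\<open>weighted_poisson_kernel\<close>). Both weights are treated at once
  by a sign \<open>\<sigma>\<close>.

  The first ratio decreases and the second increases with \<open>r\<close>, for each fixed \<open>\<xi>\<close>
  (\<open>radial_ratio_mono\<close>). The power preserves or reverses this according to the sign of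
  \<open>n + 2 \<lambda>\<close>, which is where the threshold \<open>\<lambda> = - n / 2\<close> comes from, and integration against
  the positive measure \<open>\<mu>\<close> preserves pointwise inequalities (\<open>poisson_integral_compare\<close>,
  \<open>poisson_integral_mono\<close>).

  For \<open>\<lambda> = 0\<close>, comparing the values at the radii \<open>|x|\<close> and \<open>0\<close> on the ray through \<open>x\<close> gives the
  Harnack inequality with \<open>|x|\<close> in place of \<open>r\<close>; its constants only get worse when \<open>|x|\<close> is
  replaced by a larger radius.
\<close>

section \<open>Weighted Poisson kernel on a ray\<close>

text \<open>The two weights of the theorem differ by exchanging \<open>R - r\<close> and \<open>R + r\<close>, which is the effect of
  flipping the sign \<open>\<sigma>\<close>; the argument uses \<open>\<sigma> = 1\<close> and \<open>\<sigma> = -1\<close> only.\<close>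

definition radial_weight :: "nat \<Rightarrow> real \<Rightarrow> real \<Rightarrow> real \<Rightarrow> real \<Rightarrow> real" where
  "radial_weight n lam \<sigma> R r =
     1 / R powr (real n - 2 - 2 * lam) * ((R + \<sigma> * r) ^ (n - 1) / (R - \<sigma> * r) powr (1 + 2 * lam))"

text \<open>Writing \<open>c = \<zeta> \<bullet> \<xi>\<close>, the identity \<open>|r \<zeta> - R \<xi>|\<^sup>2 = (R + \<sigma> r)\<^sup>2 - 2 \<sigma> R r (1 + \<sigma> c)\<close> reduces the
  comparison to the monotonicity of \<open>r / (R + \<sigma> r)\<^sup>2\<close>, which amounts to
  \<open>(r' - r) (R\<^sup>2 - r r') \<ge> 0\<close>. The outer factor \<open>\<sigma>\<close> decides the direction of the inequality.\<close>

lemma radial_ratio_mono: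
  fixes \<zeta> \<xi> :: "'a::real_inner"
  assumes \<sigma>: "\<sigma> = 1 \<or> \<sigma> = -1" and r: "0 \<le> r" "r \<le> r'" "r' < R"
    and unit: "norm \<zeta> = 1" "norm \<xi> = 1"
  shows "\<sigma> * ((R + \<sigma> * r) / norm (r *\<^sub>R \<zeta> - R *\<^sub>R \<xi>))
       \<le> \<sigma> * ((R + \<sigma> * r') / norm (r' *\<^sub>R \<zeta> - R *\<^sub>R \<xi>))"
proof -
  define c where "c = \<zeta> \<bullet> \<xi>"
  define N where "N s = norm (s *\<^sub>R \<zeta> - R *\<^sub>R \<xi>)" for s
  have c: "\<bar>c\<bar> \<le> 1" using Cauchy_Schwarz_ineq2[of \<zeta> \<xi>] unit by (simp add: c_def)
  have \<sigma>2: "\<sigma> * \<sigma> = 1" using \<sigma> by auto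
  have Nsq: "(N s)\<^sup>2 = (R + \<sigma> * s)\<^sup>2 - 2 * \<sigma> * R * s * (1 + \<sigma> * c)" for s
  proof -
    have "(N s)\<^sup>2 = s\<^sup>2 * (\<zeta> \<bullet> \<zeta>) - 2 * s * R * c + R\<^sup>2 * (\<xi> \<bullet> \<xi>)"
      unfolding N_def power2_norm_eq_inner c_def
      by (simp add: inner_diff_left inner_diff_right inner_commute power2_eq_square algebra_simps)
    also have "\<dots> = s\<^sup>2 - 2 * s * R * c + R\<^sup>2" using unit by (simp add: dot_square_norm)
    also have "\<dots> = (R + \<sigma> * s)\<^sup>2 - 2 * \<sigma> * R * s * (1 + \<sigma> * c)" using \<sigma>
      by (auto simp: power2_eq_square algebra_simps)
    finally show ?thesis .
  qed
  have Npos: "0 < N s" if "0 \<le> s" "s < R" for s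
  proof -
    have "norm (R *\<^sub>R \<xi>) - norm (s *\<^sub>R \<zeta>) \<le> N s" unfolding N_def
      by (metis norm_minus_commute norm_triangle_ineq2)
    then show ?thesis using that unit by simp
  qed
  have pos: "0 < R + \<sigma> * r" "0 < R + \<sigma> * r'" using \<sigma> r by auto
  have key: "0 \<le> (r' - r) * (R * R - r * r')"
  proof -
    have "r * r' \<le> R * R" using r by (intro mult_mono) auto
    then show ?thesis using r by simp
  qed
  have fac: "0 \<le> 2 * R * (1 + \<sigma> * c)" using \<sigma> c r by auto
  have n: "0 < N r" "0 < N r'" using r by (auto intro: Npos)
  define X Y P where "X = (R + \<sigma> * r) * N r'" and "Y = (R + \<sigma> * r') * N r"
    and "P = 2 * R * (1 + \<sigma> * c) * ((r' - r) * (R * R - r * r'))"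
  have diff: "Y\<^sup>2 - X\<^sup>2 = \<sigma> * P"
    unfolding X_def Y_def P_def power_mult_distrib Nsq
    using \<sigma> by (auto simp: power2_eq_square algebra_simps)
  have P: "0 \<le> P" unfolding P_def using fac key by (rule mult_nonneg_nonneg)
  have XY: "0 \<le> X" "0 \<le> Y" using pos n by (simp_all add: X_def Y_def)
  have "\<sigma> * ((R + \<sigma> * r) / N r) \<le> \<sigma> * ((R + \<sigma> * r') / N r')"
  proof (cases "\<sigma> = 1")
    case True
    then have "X\<^sup>2 \<le> Y\<^sup>2" using diff P by simp
    then have "X \<le> Y" using XY(2) by (rule power2_le_imp_le)
    then have "(R + \<sigma> * r) / N r \<le> (R + \<sigma> * r') / N r'" unfolding X_def Y_def
      using n by (simp only: pos_divide_le_eq pos_le_divide_eq times_divide_eq_left)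
    then show ?thesis using True by simp
  next
    case False
    then have s: "\<sigma> = -1" using \<sigma> by simp
    then have "Y\<^sup>2 \<le> X\<^sup>2" using diff P by simp
    then have "Y \<le> X" using XY(1) by (rule power2_le_imp_le)
    then have "(R + \<sigma> * r') / N r' \<le> (R + \<sigma> * r) / N r" unfolding X_def Y_def
      using n by (simp only: pos_divide_le_eq pos_le_divide_eq times_divide_eq_left)
    then show ?thesis by (rule mult_left_mono_neg) (simp add: s)
  qed
  then show ?thesis by (simp add: N_def)
qed

text \<open>The factor \<open>(R - \<sigma> r) powr (1 + 2 \<lambda>)\<close> of the kernel cancels, the other factor raises the
  exponent \<open>n - 1\<close> of \<open>R + \<sigma> r\<close> to \<open>n + 2 \<lambda>\<close>, and the power of \<open>R\<close> in the weight makes the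
  product homogeneous of degree zero in \<open>(r, R)\<close>.\<close>

lemma weighted_poisson_kernel:
  fixes \<zeta> \<xi> :: "real ^ 'n::finite"
  assumes \<sigma>: "\<sigma> = 1 \<or> \<sigma> = -1" and r: "0 \<le> r" "r < R"
    and unit: "norm \<zeta> = 1" "norm \<xi> = 1"
  shows "radial_weight CARD('n) lam \<sigma> R r * poisson_kernel lam ((r *\<^sub>R \<zeta>) /\<^sub>R R) \<xi>
       = ((R + \<sigma> * r) / norm (r *\<^sub>R \<zeta> - R *\<^sub>R \<xi>)) powr (real CARD('n) + 2 * lam)"
proof -
  define A B N where "A = R + \<sigma> * r" and "B = R - \<sigma> * r" and "N = norm (r *\<^sub>R \<zeta> - R *\<^sub>R \<xi>)"
  have R: "0 < R" using r by simp
  have A: "0 < A" and B: "0 < B" using \<sigma> r by (auto simp: A_def B_def)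
  have N0: "0 \<le> N" by (simp add: N_def)
  have "norm ((r *\<^sub>R \<zeta>) /\<^sub>R R) = r / R" using r unit by (simp add: divide_inverse mult.commute)
  then have base: "1 - (norm ((r *\<^sub>R \<zeta>) /\<^sub>R R))\<^sup>2 = A * B / R powr 2"
    using R \<sigma> by (auto simp: A_def B_def field_simps power2_eq_square powr_numeral)
  have "(r *\<^sub>R \<zeta>) /\<^sub>R R - \<xi> = inverse R *\<^sub>R (r *\<^sub>R \<zeta> - R *\<^sub>R \<xi>)"
    using R by (simp add: algebra_simps)
  then have dist: "norm ((r *\<^sub>R \<zeta>) /\<^sub>R R - \<xi>) = N / R"
    using R by (simp add: N_def divide_inverse mult.commute)
  have card: "real (CARD('n) - 1) = real CARD('n) - 1" by (simp add: Suc_le_eq of_nat_diff)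
  have "radial_weight CARD('n) lam \<sigma> R r * poisson_kernel lam ((r *\<^sub>R \<zeta>) /\<^sub>R R) \<xi>
     = 1 / R powr (real CARD('n) - 2 - 2 * lam)
        * (A powr (real CARD('n) - 1) / B powr (1 + 2 * lam))
        * ((A * B / R powr 2) powr (1 + 2 * lam) / (N / R) powr (real CARD('n) + 2 * lam))"
    unfolding radial_weight_def poisson_kernel_def base dist A_def[symmetric] B_def[symmetric]
    using A by (simp add: card flip: powr_realpow)
  also have "\<dots> = (A powr (real CARD('n) - 1) * A powr (1 + 2 * lam))
       * (R powr (real CARD('n) + 2 * lam)
          / (R powr (real CARD('n) - 2 - 2 * lam) * R powr (2 * (1 + 2 * lam))))
       / N powr (real CARD('n) + 2 * lam)"
  proof -
    have kernel_num: "(A * B / R powr 2) powr (1 + 2 * lam)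
        = A powr (1 + 2 * lam) * B powr (1 + 2 * lam) / R powr (2 * (1 + 2 * lam))"
      using A B R by (simp only: powr_mult powr_divide powr_powr powr_ge_zero less_imp_le
          mult_nonneg_nonneg)
    have kernel_den: "(N / R) powr (real CARD('n) + 2 * lam)
        = N powr (real CARD('n) + 2 * lam) / R powr (real CARD('n) + 2 * lam)"
      using N0 R by (simp add: powr_divide)
    show ?thesis unfolding kernel_num kernel_den using B by simp
  qed
  also have "R powr (real CARD('n) - 2 - 2 * lam) * R powr (2 * (1 + 2 * lam))
       = R powr (real CARD('n) + 2 * lam)"
    by (simp add: algebra_simps flip: powr_add)
  also have "A powr (real CARD('n) - 1) * A powr (1 + 2 * lam) = A powr (real CARD('n) + 2 * lam)"
    by (simp flip: powr_add)
  finally show ?thesis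
    using A N0 R by (simp add: powr_divide A_def[symmetric] N_def[symmetric])
qed

lemma weighted_poisson_kernel_mono:
  fixes \<zeta> \<xi> :: "real ^ 'n::finite"
    and lam :: real
  assumes \<sigma>: "\<sigma> = 1 \<or> \<sigma> = -1" and r: "0 \<le> r" "r \<le> r'" "r' < R"
    and unit: "norm \<zeta> = 1" "norm \<xi> = 1"
  defines "K \<equiv> \<lambda>r. radial_weight CARD('n) lam \<sigma> R r * poisson_kernel lam ((r *\<^sub>R \<zeta>) /\<^sub>R R) \<xi>"
  shows "0 \<le> \<sigma> * (real CARD('n) + 2 * lam) \<Longrightarrow> K r \<le> K r'"
    and "\<sigma> * (real CARD('n) + 2 * lam) \<le> 0 \<Longrightarrow> K r' \<le> K r"
proof -
  define e where "e = real CARD('n) + 2 * lam"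
  define Q where "Q s = (R + \<sigma> * s) / norm (s *\<^sub>R \<zeta> - R *\<^sub>R \<xi>)" for s
  have K: "K r = Q r powr e" "K r' = Q r' powr e"
    using weighted_poisson_kernel[OF \<sigma> _ _ unit] r by (auto simp: K_def Q_def e_def)
  have Qpos: "0 < Q s" if "0 \<le> s" "s < R" for s
  proof -
    have "norm (s *\<^sub>R \<zeta>) \<noteq> norm (R *\<^sub>R \<xi>)" using that unit by simp
    then have "s *\<^sub>R \<zeta> \<noteq> R *\<^sub>R \<xi>" by metis
    then show ?thesis using that \<sigma> by (auto simp: Q_def)
  qed
  have pos: "0 < Q r" "0 < Q r'" using r by (auto intro: Qpos)
  have le: "\<sigma> * Q r \<le> \<sigma> * Q r'" unfolding Q_def by (rule radial_ratio_mono[OF \<sigma> r unit])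
  show "K r \<le> K r'" if "0 \<le> \<sigma> * (real CARD('n) + 2 * lam)"
    using \<sigma> that le pos unfolding K e_def[symmetric] by (auto intro: powr_mono2 powr_mono2')
  show "K r' \<le> K r" if "\<sigma> * (real CARD('n) + 2 * lam) \<le> 0"
    using \<sigma> that le pos unfolding K e_def[symmetric] by (auto intro: powr_mono2 powr_mono2')
qed

section \<open>Radial monotonicity of Poisson integrals\<close>

text \<open>The nonnegative integral is monotone and commutes with nonnegative constants, so an
  inequality between multiples of the kernel at two points passes to the function that the
  kernel represents.\<close>

lemma poisson_integral_compare:
  fixes \<mu> :: "(real ^ 'n::finite) measure"
  assumes sets: "sets \<mu> = sets (restrict_space borel (sphere 0 1))"
    and u: "\<And>x. x \<in> ball 0 R \<Longrightarrow>
          ennreal (u x) = (\<integral>\<^sup>+ \<xi>. ennreal (poisson_kernel lam (x /\<^sub>R R) \<xi>) \<partial>\<mu>)"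
    and pos: "\<And>x. x \<in> ball 0 R \<Longrightarrow> 0 < u x"
    and xy: "x \<in> ball 0 R" "y \<in> ball 0 R" and ab: "0 \<le> a" "0 \<le> b"
    and le: "\<And>\<xi>. norm \<xi> = 1 \<Longrightarrow>
          a * poisson_kernel lam (x /\<^sub>R R) \<xi> \<le> b * poisson_kernel lam (y /\<^sub>R R) \<xi>"
  shows "a * u x \<le> b * u y"
proof -
  have space: "space \<mu> = sphere 0 1"
    using sets_eq_imp_space_eq[OF sets] by (simp add: space_restrict_space)
  have meas: "(\<lambda>\<xi>. ennreal (poisson_kernel lam z \<xi>)) \<in> borel_measurable \<mu>" for z
  proof -
    have "(\<lambda>\<xi>. ennreal (poisson_kernel lam z \<xi>)) \<in> borel_measurable borel"
      unfolding poisson_kernel_def by measurable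
    then have "(\<lambda>\<xi>. ennreal (poisson_kernel lam z \<xi>))
        \<in> borel_measurable (restrict_space borel (sphere 0 1))"
      by (rule measurable_restrict_space1)
    then show ?thesis using measurable_cong_sets[OF sets refl] by blast
  qed
  have scaled: "ennreal (c * u z) = (\<integral>\<^sup>+ \<xi>. ennreal (c * poisson_kernel lam (z /\<^sub>R R) \<xi>) \<partial>\<mu>)"
    if "0 \<le> c" "z \<in> ball 0 R" for c z
    using that by (simp add: ennreal_mult' u nn_integral_cmult[OF meas])
  have "ennreal (a * u x) \<le> ennreal (b * u y)"
    unfolding scaled[OF ab(1) xy(1)] scaled[OF ab(2) xy(2)]
    by (intro nn_integral_mono ennreal_leI le) (simp add: space)
  moreover have "0 \<le> b * u y" using ab pos[OF xy(2)] by simp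
  ultimately show ?thesis by (simp add: ennreal_le_iff)
qed

lemma poisson_integral_mono:
  fixes \<mu> :: "(real ^ 'n::finite) measure"
  assumes sets: "sets \<mu> = sets (restrict_space borel (sphere 0 1))"
    and u: "\<And>x. x \<in> ball 0 R \<Longrightarrow>
          ennreal (u x) = (\<integral>\<^sup>+ \<xi>. ennreal (poisson_kernel lam (x /\<^sub>R R) \<xi>) \<partial>\<mu>)"
    and pos: "\<And>x. x \<in> ball 0 R \<Longrightarrow> 0 < u x"
    and \<zeta>: "norm \<zeta> = 1" and \<sigma>: "\<sigma> = 1 \<or> \<sigma> = -1"
  shows "0 \<le> \<sigma> * (real CARD('n) + 2 * lam) \<Longrightarrow>
      mono_on {0..<R} (\<lambda>r. radial_weight CARD('n) lam \<sigma> R r * u (r *\<^sub>R \<zeta>))"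
    and "\<sigma> * (real CARD('n) + 2 * lam) \<le> 0 \<Longrightarrow>
      antimono_on {0..<R} (\<lambda>r. radial_weight CARD('n) lam \<sigma> R r * u (r *\<^sub>R \<zeta>))"
proof -
  have w: "0 \<le> radial_weight CARD('n) lam \<sigma> R r" if "0 \<le> r" "r < R" for r
    using that \<sigma> by (auto simp: radial_weight_def)
  have b: "r *\<^sub>R \<zeta> \<in> ball 0 R" if "0 \<le> r" "r < R" for r using that \<zeta> by simp
  show "mono_on {0..<R} (\<lambda>r. radial_weight CARD('n) lam \<sigma> R r * u (r *\<^sub>R \<zeta>))"
    if "0 \<le> \<sigma> * (real CARD('n) + 2 * lam)"
    by (intro mono_onI poisson_integral_compare[OF sets u pos] b w
        weighted_poisson_kernel_mono(1)[OF \<sigma> _ _ _ \<zeta> _ that]) auto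
  show "antimono_on {0..<R} (\<lambda>r. radial_weight CARD('n) lam \<sigma> R r * u (r *\<^sub>R \<zeta>))"
    if "\<sigma> * (real CARD('n) + 2 * lam) \<le> 0"
    by (intro monotone_onI poisson_integral_compare[OF sets u pos] b w
        weighted_poisson_kernel_mono(2)[OF \<sigma> _ _ _ \<zeta> _ that]) auto
qed

section \<open>Harnack inequality in the harmonic case\<close>

lemma radial_weight_harmonic:
  assumes "2 \<le> n" "0 < R" "\<bar>\<sigma> * r\<bar> < R"
  shows "radial_weight n 0 \<sigma> R r = ((R + \<sigma> * r) / R) ^ (n - 2) * ((R + \<sigma> * r) / (R - \<sigma> * r))"
proof -
  obtain m where n: "n = Suc (Suc m)" using assms(1) by (metis add_2_eq_Suc le_Suc_ex)
  have "R powr real m = R ^ m" using assms(2) by (simp add: powr_realpow)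
  moreover have "0 < R - \<sigma> * r" using assms(3) by linarith
  ultimately show ?thesis by (simp add: radial_weight_def n power_divide)
qed

text \<open>At \<open>r = 0\<close> both weights equal \<open>1\<close> when \<open>\<lambda> = 0\<close>, so radial monotonicity compares the weighted value
  at \<open>x\<close> directly with \<open>u 0\<close>. Multiplying by the reciprocal of the weight isolates \<open>u x\<close>.\<close>

lemma harnack_bounds:
  fixes \<mu> :: "(real ^ 'n::finite) measure"
  assumes n: "2 \<le> CARD('n)" and R: "0 < R"
    and sets: "sets \<mu> = sets (restrict_space borel (sphere 0 1))"
    and u: "\<And>x. x \<in> ball 0 R \<Longrightarrow>
          ennreal (u x) = (\<integral>\<^sup>+ \<xi>. ennreal (poisson_kernel 0 (x /\<^sub>R R) \<xi>) \<partial>\<mu>)"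
    and pos: "\<And>x. x \<in> ball 0 R \<Longrightarrow> 0 < u x"
    and r: "norm x \<le> r" "r < R"
  shows "(R / (R + r)) ^ (CARD('n) - 2) * ((R - r) / (R + r)) * u 0 \<le> u x"
    and "u x \<le> (R / (R - r)) ^ (CARD('n) - 2) * ((R + r) / (R - r)) * u 0"
proof -
  define \<rho> where "\<rho> = norm x"
  define k where "k = CARD('n) - 2"
  \<comment> \<open>At \<open>x = 0\<close> the ray has no distinguished direction and any unit vector serves.\<close>
  obtain \<zeta> :: "real ^ 'n" where \<zeta>: "norm \<zeta> = 1" "x = \<rho> *\<^sub>R \<zeta>"
  proof (cases "x = 0")
    case True
    then show ?thesis using that[of "axis undefined 1"] by (simp add: \<rho>_def)
  next
    case False
    then show ?thesis using that[of "sgn x"] by (simp add: \<rho>_def norm_sgn sgn_div_norm)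
  qed
  have \<rho>: "0 \<le> \<rho>" "\<rho> \<le> r" "\<rho> < R" using r by (auto simp: \<rho>_def)
  have u0: "0 \<le> u 0" using pos[of 0] R by simp
  have W: "radial_weight CARD('n) 0 \<sigma> R s = ((R + \<sigma> * s) / R) ^ k * ((R + \<sigma> * s) / (R - \<sigma> * s))"
    if "\<sigma> = 1 \<or> \<sigma> = -1" "0 \<le> s" "s < R" for \<sigma> s
    unfolding k_def using n R that by (intro radial_weight_harmonic) auto
  have "radial_weight CARD('n) 0 1 R 0 * u (0 *\<^sub>R \<zeta>) \<le> radial_weight CARD('n) 0 1 R \<rho> * u (\<rho> *\<^sub>R \<zeta>)"
    using \<rho> R by (intro mono_onD[OF poisson_integral_mono(1)[OF sets u pos \<zeta>(1)]]) auto
  then have low: "u 0 \<le> ((R + \<rho>) / R) ^ k * ((R + \<rho>) / (R - \<rho>)) * u x"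
    using \<rho> R by (simp add: W \<zeta>(2)[symmetric])
  have "radial_weight CARD('n) 0 (-1) R \<rho> * u (\<rho> *\<^sub>R \<zeta>) \<le> radial_weight CARD('n) 0 (-1) R 0 * u (0 *\<^sub>R \<zeta>)"
    using \<rho> R by (intro monotone_onD[OF poisson_integral_mono(2)[OF sets u pos \<zeta>(1)]]) auto
  then have up: "((R - \<rho>) / R) ^ k * ((R - \<rho>) / (R + \<rho>)) * u x \<le> u 0"
    using \<rho> R by (simp add: W \<zeta>(2)[symmetric])
  have "(R / (R + r)) ^ k * ((R - r) / (R + r)) * u 0
      \<le> (R / (R + \<rho>)) ^ k * ((R - \<rho>) / (R + \<rho>)) * u 0"
    using \<rho> r R u0
    by (intro mult_right_mono mult_mono power_mono frac_le divide_left_mono) auto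
  also have "\<dots> \<le> (R / (R + \<rho>)) ^ k * ((R - \<rho>) / (R + \<rho>))
      * (((R + \<rho>) / R) ^ k * ((R + \<rho>) / (R - \<rho>)) * u x)"
    using \<rho> R by (intro mult_left_mono low) auto
  also have "\<dots> = u x" using \<rho> R by (simp add: power_divide)
  finally show "(R / (R + r)) ^ (CARD('n) - 2) * ((R - r) / (R + r)) * u 0 \<le> u x"
    by (simp add: k_def)
  have "u x = (R / (R - \<rho>)) ^ k * ((R + \<rho>) / (R - \<rho>))
      * (((R - \<rho>) / R) ^ k * ((R - \<rho>) / (R + \<rho>)) * u x)"
    using \<rho> R by (simp add: power_divide)
  also have "\<dots> \<le> (R / (R - \<rho>)) ^ k * ((R + \<rho>) / (R - \<rho>)) * u 0"
    using \<rho> R by (intro mult_left_mono up) auto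
  also have "\<dots> \<le> (R / (R - r)) ^ k * ((R + r) / (R - r)) * u 0"
    using \<rho> r R u0
    by (intro mult_right_mono mult_mono power_mono frac_le divide_left_mono) auto
  finally show "u x \<le> (R / (R - r)) ^ (CARD('n) - 2) * ((R + r) / (R - r)) * u 0"
    by (simp add: k_def)
qed

theorem corollary1p6:
  fixes \<mu> :: "(real ^ 'n::finite) measure"
    and u :: "real ^ 'n \<Rightarrow> real"
    and \<zeta> :: "real ^ 'n"
    and R lam :: real
  assumes "2 \<le> CARD('n)"
    and "0 < R"
    and "sets \<mu> = sets (restrict_space borel (sphere 0 1))"
    and "\<And>x. x \<in> ball 0 R \<Longrightarrow>
          ennreal (u x) = (\<integral>\<^sup>+ \<xi>. ennreal (poisson_kernel lam (x /\<^sub>R R) \<xi>) \<partial>\<mu>)"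
    and "\<And>x. x \<in> ball 0 R \<Longrightarrow> 0 < u x"
    and "invariant_harmonic_ball R lam u"
    and "\<zeta> \<in> sphere 0 1"
  shows
    "(lam > - real CARD('n) / 2 \<longrightarrow>
        antimono_on {0..<R} (\<lambda>r. 1 / R powr (real CARD('n) - 2 - 2 * lam) *
          ((R - r) ^ (CARD('n) - 1) / (R + r) powr (1 + 2 * lam)) * u (r *\<^sub>R \<zeta>)) \<and>
        mono_on {0..<R} (\<lambda>r. 1 / R powr (real CARD('n) - 2 - 2 * lam) *
          ((R + r) ^ (CARD('n) - 1) / (R - r) powr (1 + 2 * lam)) * u (r *\<^sub>R \<zeta>))) \<and>
     (lam < - real CARD('n) / 2 \<longrightarrow>
        mono_on {0..<R} (\<lambda>r. 1 / R powr (real CARD('n) - 2 - 2 * lam) *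
          ((R - r) ^ (CARD('n) - 1) / (R + r) powr (1 + 2 * lam)) * u (r *\<^sub>R \<zeta>)) \<and>
        antimono_on {0..<R} (\<lambda>r. 1 / R powr (real CARD('n) - 2 - 2 * lam) *
          ((R + r) ^ (CARD('n) - 1) / (R - r) powr (1 + 2 * lam)) * u (r *\<^sub>R \<zeta>))) \<and>
     (lam = 0 \<longrightarrow>
        antimono_on {0..<R}
          (\<lambda>r. ((R - r) / R) ^ (CARD('n) - 2) * ((R - r) / (R + r)) * u (r *\<^sub>R \<zeta>)) \<and>
        mono_on {0..<R}
          (\<lambda>r. ((R + r) / R) ^ (CARD('n) - 2) * ((R + r) / (R - r)) * u (r *\<^sub>R \<zeta>)) \<and>
        (\<forall>r x. 0 \<le> r \<and> r < R \<and> x \<in> ball 0 r \<longrightarrow>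
           (R / (R + r)) ^ (CARD('n) - 2) * ((R - r) / (R + r)) * u 0 \<le> u x \<and>
           u x \<le> (R / (R - r)) ^ (CARD('n) - 2) * ((R + r) / (R - r)) * u 0))"
proof -
  note basic = assms(3-5)
  have \<zeta>: "norm \<zeta> = 1" using assms(7) by simp
  have plus: "radial_weight CARD('n) lam 1 R = (\<lambda>r. 1 / R powr (real CARD('n) - 2 - 2 * lam) *
      ((R + r) ^ (CARD('n) - 1) / (R - r) powr (1 + 2 * lam)))"
    and minus: "radial_weight CARD('n) lam (-1) R = (\<lambda>r. 1 / R powr (real CARD('n) - 2 - 2 * lam) *
      ((R - r) ^ (CARD('n) - 1) / (R + r) powr (1 + 2 * lam)))"
    by (auto simp: radial_weight_def)
  note up = poisson_integral_mono(1)[OF basic \<zeta>] and down = poisson_integral_mono(2)[OF basic \<zeta>]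
  have harmonic: "antimono_on {0..<R}
          (\<lambda>r. ((R - r) / R) ^ (CARD('n) - 2) * ((R - r) / (R + r)) * u (r *\<^sub>R \<zeta>)) \<and>
        mono_on {0..<R}
          (\<lambda>r. ((R + r) / R) ^ (CARD('n) - 2) * ((R + r) / (R - r)) * u (r *\<^sub>R \<zeta>)) \<and>
        (\<forall>r x. 0 \<le> r \<and> r < R \<and> x \<in> ball 0 r \<longrightarrow>
           (R / (R + r)) ^ (CARD('n) - 2) * ((R - r) / (R + r)) * u 0 \<le> u x \<and>
           u x \<le> (R / (R - r)) ^ (CARD('n) - 2) * ((R + r) / (R - r)) * u 0)"
    if lam: "lam = 0"
  proof (intro conjI allI impI)
    have W: "radial_weight CARD('n) lam \<sigma> R r
        = ((R + \<sigma> * r) / R) ^ (CARD('n) - 2) * ((R + \<sigma> * r) / (R - \<sigma> * r))"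
      if "\<sigma> = 1 \<or> \<sigma> = -1" "r \<in> {0..<R}" for \<sigma> r
      unfolding lam using that assms(1,2) by (intro radial_weight_harmonic) auto
    have "antimono_on {0..<R} (\<lambda>r. radial_weight CARD('n) lam (-1) R r * u (r *\<^sub>R \<zeta>))"
      by (rule down) (auto simp: lam)
    then show "antimono_on {0..<R}
        (\<lambda>r. ((R - r) / R) ^ (CARD('n) - 2) * ((R - r) / (R + r)) * u (r *\<^sub>R \<zeta>))"
      by (simp add: monotone_on_def W)
    have "mono_on {0..<R} (\<lambda>r. radial_weight CARD('n) lam 1 R r * u (r *\<^sub>R \<zeta>))"
      by (rule up) (auto simp: lam)
    then show "mono_on {0..<R}
        (\<lambda>r. ((R + r) / R) ^ (CARD('n) - 2) * ((R + r) / (R - r)) * u (r *\<^sub>R \<zeta>))"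
      by (simp add: monotone_on_def W)
    fix r and x :: "real ^ 'n" assume "0 \<le> r \<and> r < R \<and> x \<in> ball 0 r"
    then have rx: "norm x \<le> r" "r < R" by auto
    show "(R / (R + r)) ^ (CARD('n) - 2) * ((R - r) / (R + r)) * u 0 \<le> u x"
      "u x \<le> (R / (R - r)) ^ (CARD('n) - 2) * ((R + r) / (R - r)) * u 0"
      using harnack_bounds[OF assms(1,2) basic[unfolded lam] rx] by auto
  qed
  show ?thesis
    using up[of 1] up[of "-1"] down[of 1] down[of "-1"] harmonic
    unfolding plus minus by auto
qed

end
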